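(* For a pseudo-BCI algebra $A$ the following are equivalent: (a) $A$ is $p$-semisimple; (b) $\mathrm{Ker}(d)=\{1\}$ for every regular type II implicative derivation $d$ on $A$; (c) the identity map $\mathrm{Id}_A$ is the only regular type II implicative derivation on $A$.
   Context: A pseudo-BCI algebra is a structure $(A,\to,\rightsquigarrow,1)$ of type $(2,2,0)$ such that for all $x,y,z\in A$: $(x\to y)\rightsquigarrow[(y\to z)\rightsquigarrow(x\to z)]=1$; $(x\rightsquigarrow y)\to[(y\rightsquigarrow z)\to(x\rightsquigarrow z)]=1$; $1\to x=x$; $1\rightsquigarrow x=x$; and $x\to y=1$, $y\to x=1$ imply $x=y$. Write $x\le y$ iff $x\to y=1$. $A$ is $p$-semisimple if $x\le 1$ implies $x=1$ for all $x\in A$. Put $x\Cup_1 y=(x\to y)\rightsquigarrow y$ and $x\Cup_2 y=(x\rightsquigarrow y)\to y$. A map $d:A\to A$ is a type II implicative derivation if $d(x\to y)=(d(x)\to y)\Cup_2(x\to d(y))$ and $d(x\rightsquigarrow y)=(d(x)\rightsquigarrow y)\Cup_1(x\rightsquigarrow d(y))$ for all $x,y\in A$; it is regular if $d(1)=1$. $\mathrm{Ker}(d)=\{x\in A\mid d(x)=1\}$. *)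

theory Defs
  imports Main
begin

text \<open>The carrier of the algebra is the whole type. The operations \<open>\<rightarrow>\<close> and
  \<open>\<leadsto>\<close> are called \<open>imp\<close> and \<open>rimp\<close>.\<close>

locale pseudo_BCI =
  fixes imp :: "'a \<Rightarrow> 'a \<Rightarrow> 'a" (infixr \<open>\<rightarrow>\<close> 65)
    and rimp :: "'a \<Rightarrow> 'a \<Rightarrow> 'a" (infixr \<open>\<leadsto>\<close> 65)
    and one :: 'a (\<open>\<one>\<close>)
  assumes imp_trans: "(x \<rightarrow> y) \<leadsto> ((y \<rightarrow> z) \<leadsto> (x \<rightarrow> z)) = \<one>"
    and rimp_trans: "(x \<leadsto> y) \<rightarrow> ((y \<leadsto> z) \<rightarrow> (x \<leadsto> z)) = \<one>"
    and one_imp: "\<one> \<rightarrow> x = x"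
    and one_rimp: "\<one> \<leadsto> x = x"
    and imp_antisym: "x \<rightarrow> y = \<one> \<Longrightarrow> y \<rightarrow> x = \<one> \<Longrightarrow> x = y"

definition pbci_le :: "('a \<Rightarrow> 'a \<Rightarrow> 'a) \<Rightarrow> 'a \<Rightarrow> 'a \<Rightarrow> 'a \<Rightarrow> bool" where
  "pbci_le imp one x y \<longleftrightarrow> imp x y = one"

definition p_semisimple :: "('a \<Rightarrow> 'a \<Rightarrow> 'a) \<Rightarrow> 'a \<Rightarrow> bool" where
  "p_semisimple imp one \<longleftrightarrow> (\<forall>x. pbci_le imp one x one \<longrightarrow> x = one)"

definition cup1 :: "('a \<Rightarrow> 'a \<Rightarrow> 'a) \<Rightarrow> ('a \<Rightarrow> 'a \<Rightarrow> 'a) \<Rightarrow> 'a \<Rightarrow> 'a \<Rightarrow> 'a" where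
  "cup1 imp rimp x y = rimp (imp x y) y"

definition cup2 :: "('a \<Rightarrow> 'a \<Rightarrow> 'a) \<Rightarrow> ('a \<Rightarrow> 'a \<Rightarrow> 'a) \<Rightarrow> 'a \<Rightarrow> 'a \<Rightarrow> 'a" where
  "cup2 imp rimp x y = imp (rimp x y) y"

definition type_II_implicative_derivation ::
  "('a \<Rightarrow> 'a \<Rightarrow> 'a) \<Rightarrow> ('a \<Rightarrow> 'a \<Rightarrow> 'a) \<Rightarrow> ('a \<Rightarrow> 'a) \<Rightarrow> bool" where
  "type_II_implicative_derivation imp rimp d \<longleftrightarrow>
     (\<forall>x y. d (imp x y) = cup2 imp rimp (imp (d x) y) (imp x (d y)) \<and>
            d (rimp x y) = cup1 imp rimp (rimp (d x) y) (rimp x (d y)))"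

definition regular_map :: "'a \<Rightarrow> ('a \<Rightarrow> 'a) \<Rightarrow> bool" where
  "regular_map one d \<longleftrightarrow> d one = one"

definition Ker :: "'a \<Rightarrow> ('a \<Rightarrow> 'a) \<Rightarrow> 'a set" where
  "Ker one d = {x. d x = one}"

end

theory Submission
  imports Defs
begin

text \<open>A type II implicative derivation \<open>d\<close> satisfies \<open>d x = d (\<one> \<rightarrow> x) = (x \<leadsto> d x) \<rightarrow> d x\<close>
  when it is regular, so \<open>x \<le> d x\<close>; in a p-semisimple algebra the order is equality, so \<open>d\<close>
  is the identity. Conversely, double negation \<open>x \<mapsto> (x \<rightarrow> \<one>) \<rightarrow> \<one>\<close> is always a regular
  type II implicative derivation, and its kernel contains every \<open>x \<le> \<one>\<close>. If its kernel is
  trivial, or if it is the identity, then the algebra is p-semisimple.\<close>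

context pseudo_BCI
begin

lemma le_rimp_imp: "x \<rightarrow> ((x \<leadsto> y) \<rightarrow> y) = \<one>"
  using rimp_trans[of \<one> x y] by (simp add: one_rimp)

lemma le_imp_rimp: "x \<leadsto> ((x \<rightarrow> y) \<leadsto> y) = \<one>"
  using imp_trans[of \<one> x y] by (simp add: one_imp)

text \<open>If one arrow gives \<open>\<one>\<close>, the matching law above has the form
  \<open>\<one> \<rightarrow> y\<close> or \<open>\<one> \<leadsto> y\<close> on its right, which is
  \<open>y\<close>. So both arrows induce one order.\<close>

lemma rimp_eq_one_iff: "x \<leadsto> y = \<one> \<longleftrightarrow> x \<rightarrow> y = \<one>"
  by (metis le_rimp_imp le_imp_rimp one_imp one_rimp)

text \<open>The axioms are symmetric in the arrows except for antisymmetry, which transfers because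
  the order is shared. Each result below thus yields its mirror image.\<close>

lemma dual: "pseudo_BCI (\<leadsto>) (\<rightarrow>) \<one>"
proof
  show "x = y" if "x \<leadsto> y = \<one>" and "y \<leadsto> x = \<one>" for x y
    using that unfolding rimp_eq_one_iff by (rule imp_antisym)
qed (fact imp_trans rimp_trans one_imp one_rimp)+

lemma imp_refl: "x \<rightarrow> x = \<one>"
  using le_imp_rimp[of \<one> x] by (simp add: one_imp one_rimp rimp_eq_one_iff)

lemma rimp_refl: "x \<leadsto> x = \<one>"
  by (simp add: rimp_eq_one_iff imp_refl)

lemma le_trans: "x \<rightarrow> y = \<one> \<Longrightarrow> y \<rightarrow> z = \<one> \<Longrightarrow> x \<rightarrow> z = \<one>"
  using imp_trans[of x y z] by (simp add: one_rimp)

lemma rimp_antimono: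
  assumes "x \<rightarrow> y = \<one>"
  shows "(y \<leadsto> z) \<rightarrow> (x \<leadsto> z) = \<one>"
  using rimp_trans[of x y z] assms[folded rimp_eq_one_iff] by (simp add: one_imp)

text \<open>Transitivity through \<open>y \<leadsto> z\<close> leaves the antecedent
  \<open>(y \<leadsto> z) \<rightarrow> z\<close>, which lies above \<open>y\<close> and may be
  replaced by it.\<close>

lemma exchange_le: "(x \<rightarrow> (y \<leadsto> z)) \<rightarrow> (y \<leadsto> (x \<rightarrow> z)) = \<one>"
proof (rule le_trans)
  show "(x \<rightarrow> (y \<leadsto> z)) \<rightarrow> (((y \<leadsto> z) \<rightarrow> z) \<leadsto> (x \<rightarrow> z)) = \<one>"
    using imp_trans[of x "y \<leadsto> z" z] by (simp add: rimp_eq_one_iff)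
  show "(((y \<leadsto> z) \<rightarrow> z) \<leadsto> (x \<rightarrow> z)) \<rightarrow> (y \<leadsto> (x \<rightarrow> z)) = \<one>"
    by (rule rimp_antimono[OF le_rimp_imp])
qed

lemma exchange: "x \<rightarrow> (y \<leadsto> z) = y \<leadsto> (x \<rightarrow> z)"
proof (rule imp_antisym)
  show "(y \<leadsto> (x \<rightarrow> z)) \<rightarrow> (x \<rightarrow> (y \<leadsto> z)) = \<one>"
    using pseudo_BCI.exchange_le[OF dual, of y x z] by (simp only: rimp_eq_one_iff)
qed (rule exchange_le)

text \<open>There is only one negation, so double negation is the same for either arrow.\<close>

lemma rimp_one: "x \<leadsto> \<one> = x \<rightarrow> \<one>"
  using exchange[of x x x] by (simp add: imp_refl rimp_refl)

lemma imp_mono: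
  assumes "x \<rightarrow> y = \<one>"
  shows "(z \<rightarrow> x) \<rightarrow> (z \<rightarrow> y) = \<one>"
  using imp_trans[of z x y] assms by (simp add: one_rimp rimp_eq_one_iff)

lemma imp_one_distrib: "(x \<rightarrow> y) \<rightarrow> \<one> = (x \<rightarrow> \<one>) \<leadsto> (y \<rightarrow> \<one>)"
proof (rule imp_antisym)
  have "y \<leadsto> (x \<rightarrow> y) = x \<rightarrow> \<one>"
    by (simp add: exchange[symmetric] rimp_refl)
  then have "(x \<rightarrow> \<one>) \<rightarrow> (((x \<rightarrow> y) \<rightarrow> \<one>) \<rightarrow> (y \<rightarrow> \<one>)) = \<one>"
    using rimp_trans[of y "x \<rightarrow> y" \<one>] by (simp add: rimp_one)
  then show "((x \<rightarrow> y) \<rightarrow> \<one>) \<rightarrow> ((x \<rightarrow> \<one>) \<leadsto> (y \<rightarrow> \<one>)) = \<one>"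
    by (simp add: exchange rimp_eq_one_iff)
next
  \<comment> \<open>Contraposition, rearranged by exchange, bounds
    \<open>y \<rightarrow> \<one>\<close> from above. Prefixing
    \<open>x \<rightarrow> \<one>\<close> to that bound makes it collapse to
    \<open>(x \<rightarrow> y) \<rightarrow> \<one>\<close>.\<close>
  have "(x \<rightarrow> y) \<rightarrow> ((y \<rightarrow> \<one>) \<leadsto> (x \<rightarrow> \<one>)) = \<one>"
    using imp_trans[of x y \<one>] by (simp add: rimp_eq_one_iff)
  then have "(y \<rightarrow> \<one>) \<leadsto> ((x \<rightarrow> y) \<rightarrow> (x \<rightarrow> \<one>)) = \<one>"
    by (simp add: exchange)
  then have "((x \<rightarrow> \<one>) \<leadsto> (y \<rightarrow> \<one>)) \<rightarrow> ((x \<rightarrow> \<one>) \<leadsto> ((x \<rightarrow> y) \<rightarrow> (x \<rightarrow> \<one>))) = \<one>"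
    using pseudo_BCI.imp_mono[OF dual, of "y \<rightarrow> \<one>" _ "x \<rightarrow> \<one>"]
    by (simp only: rimp_eq_one_iff)
  moreover have "(x \<rightarrow> \<one>) \<leadsto> ((x \<rightarrow> y) \<rightarrow> (x \<rightarrow> \<one>)) = (x \<rightarrow> y) \<rightarrow> \<one>"
    by (simp add: exchange[symmetric] rimp_refl)
  ultimately show "((x \<rightarrow> \<one>) \<leadsto> (y \<rightarrow> \<one>)) \<rightarrow> ((x \<rightarrow> y) \<rightarrow> \<one>) = \<one>"
    by simp
qed

lemma rimp_one_distrib: "(x \<leadsto> y) \<rightarrow> \<one> = (x \<rightarrow> \<one>) \<rightarrow> (y \<rightarrow> \<one>)"
  using pseudo_BCI.imp_one_distrib[OF dual, of x y] by (simp add: rimp_one)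

definition dneg :: "'a \<Rightarrow> 'a" where
  "dneg x = (x \<rightarrow> \<one>) \<rightarrow> \<one>"

lemma dneg_dual: "pseudo_BCI.dneg (\<leadsto>) \<one> = dneg"
  by (simp add: fun_eq_iff dneg_def pseudo_BCI.dneg_def[OF dual] rimp_one)

lemma le_dneg: "x \<rightarrow> dneg x = \<one>"
  using le_rimp_imp[of x \<one>] by (simp add: dneg_def rimp_one)

text \<open>Negation distributes over an arrow while swapping it for the other one; a second
  negation swaps it back.\<close>

lemma dneg_imp: "dneg (x \<rightarrow> y) = dneg x \<rightarrow> dneg y"
  by (simp only: dneg_def imp_one_distrib[of x y]
      rimp_one_distrib[of "x \<rightarrow> \<one>" "y \<rightarrow> \<one>"])

text \<open>By exchange, an implication into \<open>dneg y\<close> depends on its antecedent only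
  through the negation of the latter, and triple negation is single negation.\<close>

lemma imp_dneg: "x \<rightarrow> dneg y = dneg x \<rightarrow> dneg y"
proof -
  have neg_dneg: "dneg x \<rightarrow> \<one> = x \<rightarrow> \<one>"
  proof (rule imp_antisym)
    show "(x \<rightarrow> \<one>) \<rightarrow> (dneg x \<rightarrow> \<one>) = \<one>"
      using le_dneg[of "x \<rightarrow> \<one>"] by (simp add: dneg_def)
    show "(dneg x \<rightarrow> \<one>) \<rightarrow> (x \<rightarrow> \<one>) = \<one>"
      using rimp_antimono[OF le_dneg, of x \<one>] by (simp add: rimp_one)
  qed
  have "z \<rightarrow> dneg y = (y \<rightarrow> \<one>) \<leadsto> (z \<rightarrow> \<one>)" for z
    using exchange[of z "y \<rightarrow> \<one>" \<one>] by (simp add: dneg_def rimp_one)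
  then show ?thesis
    by (simp add: neg_dneg)
qed

text \<open>The first argument of \<open>cup2\<close> lies below the second because \<open>y\<close>
  lies below \<open>dneg y\<close>. In that case \<open>cup2\<close> returns its second argument,
  here \<open>dneg x \<rightarrow> dneg y\<close>.\<close>

lemma dneg_imp_cup2:
  "dneg (x \<rightarrow> y) = cup2 (\<rightarrow>) (\<leadsto>) (dneg x \<rightarrow> y) (x \<rightarrow> dneg y)"
proof -
  have "(dneg x \<rightarrow> y) \<leadsto> (x \<rightarrow> dneg y) = \<one>"
    using imp_mono[OF le_dneg, of "dneg x" y] by (simp only: imp_dneg[of x] rimp_eq_one_iff)
  then show ?thesis
    by (simp add: cup2_def one_imp dneg_imp imp_dneg[of x])
qed

lemma dneg_derivation: "type_II_implicative_derivation (\<rightarrow>) (\<leadsto>) dneg"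
  \<comment> \<open>Swapping the arrows exchanges \<open>cup1\<close> and \<open>cup2\<close> and
    fixes \<open>dneg\<close>, so the second identity is the dual of the first.\<close>
  using dneg_imp_cup2 pseudo_BCI.dneg_imp_cup2[OF dual]
  by (simp add: type_II_implicative_derivation_def dneg_dual cup1_def cup2_def)

lemma dneg_le_one: "x \<rightarrow> \<one> = \<one> \<Longrightarrow> dneg x = \<one>"
  by (simp add: dneg_def imp_refl)

lemma dneg_regular: "regular_map \<one> dneg"
  by (simp add: regular_map_def dneg_le_one imp_refl)

text \<open>Both joins are idempotent. Condition (c), stated as equality with \<open>{id}\<close>,
  also asks that the identity be a member.\<close>

lemma id_derivation: "type_II_implicative_derivation (\<rightarrow>) (\<leadsto>) id"
  by (simp add: type_II_implicative_derivation_def cup1_def cup2_def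
      imp_refl rimp_refl one_imp one_rimp)

lemma p_semisimple_le_eq:
  assumes "p_semisimple (\<rightarrow>) \<one>" and "x \<rightarrow> y = \<one>"
  shows "x = y"
proof (rule imp_antisym)
  \<comment> \<open>Going from \<open>x\<close> to \<open>y\<close> and back to \<open>x\<close>
    puts \<open>y \<rightarrow> x\<close> below \<open>x \<rightarrow> x = \<one>\<close>, where
    p-semisimplicity applies.\<close>
  have "(y \<rightarrow> x) \<rightarrow> \<one> = \<one>"
    using imp_trans[of x y x] assms(2) by (simp add: imp_refl one_rimp rimp_one)
  then show "y \<rightarrow> x = \<one>"
    using assms(1) by (simp add: p_semisimple_def pbci_le_def)
qed (fact assms(2))

lemma le_regular_derivation:
  assumes "type_II_implicative_derivation (\<rightarrow>) (\<leadsto>) d" and "regular_map \<one> d"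
  shows "x \<rightarrow> d x = \<one>"
proof -
  have "d (\<one> \<rightarrow> x) = cup2 (\<rightarrow>) (\<leadsto>) (d \<one> \<rightarrow> x) (\<one> \<rightarrow> d x)"
    using assms(1) by (simp add: type_II_implicative_derivation_def)
  then have "d x = (x \<leadsto> d x) \<rightarrow> d x"
    using assms(2) by (simp add: regular_map_def cup2_def one_imp)
  then show ?thesis
    using le_rimp_imp[of x "d x"] by simp
qed

lemma p_semisimple_derivation_eq_id:
  assumes "p_semisimple (\<rightarrow>) \<one>"
    and "type_II_implicative_derivation (\<rightarrow>) (\<leadsto>) d" and "regular_map \<one> d"
  shows "d = id"
proof
  fix x
  show "d x = id x"
    using p_semisimple_le_eq[OF assms(1) le_regular_derivation[OF assms(2,3)], of x] by simp
qed

lemma p_semisimple_iff_Ker: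
  "p_semisimple (\<rightarrow>) \<one> \<longleftrightarrow>
    (\<forall>d. type_II_implicative_derivation (\<rightarrow>) (\<leadsto>) d \<and> regular_map \<one> d \<longrightarrow> Ker \<one> d = {\<one>})"
proof
  assume ss: "p_semisimple (\<rightarrow>) \<one>"
  have "Ker \<one> id = {\<one>}"
    by (simp add: Ker_def)
  then show "\<forall>d. type_II_implicative_derivation (\<rightarrow>) (\<leadsto>) d \<and> regular_map \<one> d
      \<longrightarrow> Ker \<one> d = {\<one>}"
    using p_semisimple_derivation_eq_id[OF ss] by blast
next
  assume "\<forall>d. type_II_implicative_derivation (\<rightarrow>) (\<leadsto>) d \<and> regular_map \<one> d
      \<longrightarrow> Ker \<one> d = {\<one>}"
  then have "Ker \<one> dneg = {\<one>}"
    using dneg_derivation dneg_regular by blast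
  then show "p_semisimple (\<rightarrow>) \<one>"
    using dneg_le_one by (auto simp: p_semisimple_def pbci_le_def Ker_def)
qed

lemma p_semisimple_iff_only_id:
  "p_semisimple (\<rightarrow>) \<one> \<longleftrightarrow>
    {d. type_II_implicative_derivation (\<rightarrow>) (\<leadsto>) d \<and> regular_map \<one> d} = {id}"
proof
  assume "p_semisimple (\<rightarrow>) \<one>"
  then show "{d. type_II_implicative_derivation (\<rightarrow>) (\<leadsto>) d \<and> regular_map \<one> d} = {id}"
    using p_semisimple_derivation_eq_id id_derivation by (auto simp: regular_map_def)
next
  assume "{d. type_II_implicative_derivation (\<rightarrow>) (\<leadsto>) d \<and> regular_map \<one> d} = {id}"
  then have "dneg = id"
    using dneg_derivation dneg_regular by blast
  then show "p_semisimple (\<rightarrow>) \<one>"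
    using dneg_le_one by (simp add: p_semisimple_def pbci_le_def)
qed

end

theorem theorem4p1:
  fixes imp rimp :: "'a \<Rightarrow> 'a \<Rightarrow> 'a" and one :: 'a
  assumes "pseudo_BCI imp rimp one"
  shows "(p_semisimple imp one \<longleftrightarrow>
           (\<forall>d. type_II_implicative_derivation imp rimp d \<and> regular_map one d
              \<longrightarrow> Ker one d = {one}))
       \<and> (p_semisimple imp one \<longleftrightarrow>
           {d. type_II_implicative_derivation imp rimp d \<and> regular_map one d} = {id})"
  using pseudo_BCI.p_semisimple_iff_Ker[OF assms] pseudo_BCI.p_semisimple_iff_only_id[OF assms]
  by (rule conjI)

end
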